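(* For every positive integer $r$ there is an integer $m$ such that $$a_{13}(13^{2r}m-7)\not\equiv0\pmod{13}.$$ Moreover there is an integer $m$ such that $$a_{17}(17m-12)\not\equiv0\pmod{17}.$$
   Context: $a_\ell(n)$ is the number of $\ell$-core partitions of $n$, defined by $\sum_{n\ge0}a_\ell(n)q^n=\prod_{n\ge1}\frac{(1-q^{\ell n})^\ell}{1-q^n}$, with $a_\ell(n)=0$ for $n<0$. *)

theory Defs
  imports
    "HOL-Computational_Algebra.Formal_Power_Series"
    "HOL-Analysis.Infinite_Products"
    "HOL-Number_Theory.Cong"
begin

text \<open>
  The generating function is taken in the ring of integer power series, so that its coefficients
  can be reduced modulo primes. Since \<^typ>\<open>int\<close> is not a field, the quotient by \<open>1 - q\<^sup>n\<close> is
  multiplication by \<open>fps_right_inverse (1 - q\<^sup>n) 1\<close>, the power series with constant term \<open>1\<close>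
  that inverts it (see \<open>one_minus_fps_X_power_inverse\<close>). The infinite product converges in the
  topology of coefficientwise stabilisation (see \<open>core_gf_has_prod\<close>).
\<close>

definition core_factor :: "nat \<Rightarrow> nat \<Rightarrow> int fps" where
  "core_factor l n = (1 - fps_X ^ (l * n)) ^ l * fps_right_inverse (1 - fps_X ^ n) 1"

text \<open>The index is shifted because the product runs over \<open>n \<ge> 1\<close>.\<close>

definition core_gf :: "nat \<Rightarrow> int fps" where
  "core_gf l = (\<Prod>n. core_factor l (Suc n))"

definition num_cores :: "nat \<Rightarrow> int \<Rightarrow> int" where
  "num_cores l n = (if n < 0 then 0 else fps_nth (core_gf l) (nat n))"

lemma one_minus_fps_X_power_inverse:
  assumes "n > 0"
  shows "(1 - fps_X ^ n) * fps_right_inverse (1 - fps_X ^ n) 1 = (1 :: int fps)"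
  using assms by (intro fps_right_inverse) auto

lemma core_factor_mult:
  assumes "n > 0"
  shows "(1 - fps_X ^ n) * core_factor l n = (1 - fps_X ^ (l * n)) ^ l"
  using one_minus_fps_X_power_inverse[OF assms]
  by (simp add: core_factor_def mult.left_commute)

lemma fps_X_power_dvd_core_factor:
  assumes "n > 0"
  shows "fps_X ^ n dvd core_factor l n - 1"
proof -
  let ?X = "fps_X ^ n :: int fps"
  have "core_factor l n - 1 = ((1 - fps_X ^ (l * n)) ^ l - 1) + ?X * core_factor l n"
    using core_factor_mult[OF assms, of l] by (simp add: algebra_simps)
  moreover have "?X dvd (1 - fps_X ^ (l * n)) ^ l - 1"
  proof (cases "l = 0")
    case False
    have "(1 - fps_X ^ (l * n)) - 1 dvd (1 - fps_X ^ (l * n)) ^ l - (1 ^ l :: int fps)"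
      by (subst power_diff_sumr2) simp
    moreover have "?X dvd (1 - fps_X ^ (l * n)) - 1"
      using False by (simp add: le_imp_power_dvd)
    ultimately show ?thesis using dvd_trans by fastforce
  qed simp
  ultimately show ?thesis by (metis dvd_add dvd_triv_left)
qed

lemma partial_product_nth_stable:
  assumes "j \<le> N"
  shows "fps_nth (\<Prod>n\<le>N. core_factor l (Suc n)) j = fps_nth (\<Prod>n\<le>j. core_factor l (Suc n)) j"
  using assms
proof (induction N rule: dec_induct)
  case (step N)
  obtain g where "core_factor l (Suc (Suc N)) - 1 = fps_X ^ Suc (Suc N) * g"
    using fps_X_power_dvd_core_factor[of "Suc (Suc N)" l] unfolding dvd_def by blast
  then have g: "core_factor l (Suc (Suc N)) = 1 + fps_X ^ Suc (Suc N) * g"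
    by (simp add: algebra_simps)
  define P where "P = (\<Prod>n\<le>N. core_factor l (Suc n))"
  have "(\<Prod>n\<le>Suc N. core_factor l (Suc n)) = P + fps_X ^ Suc (Suc N) * (P * g)"
    unfolding prod.atMost_Suc g P_def by (simp only: algebra_simps mult_1_left)
  moreover have "fps_nth (fps_X ^ Suc (Suc N) * (P * g)) j = 0"
    using step.hyps by (subst fps_X_power_mult_nth) simp
  ultimately show ?case using step.IH by (simp add: P_def)
qed simp

lemma core_gf_has_prod: "(\<lambda>n. core_factor l (Suc n)) has_prod core_gf l"
proof -
  let ?f = "\<lambda>n. core_factor l (Suc n)"
  define F where "F = Abs_fps (\<lambda>j. fps_nth (\<Prod>n\<le>j. ?f n) j)"
  have "(\<lambda>N. \<Prod>n\<le>N. ?f n) \<longlonglongrightarrow> F"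
  proof (rule tendsto_fpsI)
    fix j show "\<forall>\<^sub>F N in sequentially. fps_nth (\<Prod>n\<le>N. ?f n) j = fps_nth F j"
      using eventually_ge_at_top[of j]
      unfolding F_def fps_nth_Abs_fps by eventually_elim (rule partial_product_nth_stable)
  qed
  moreover have "fps_nth F 0 \<noteq> 0"
  proof -
    obtain g where "core_factor l 1 - 1 = fps_X ^ 1 * g"
      using fps_X_power_dvd_core_factor[of 1 l] unfolding dvd_def by auto
    then have "fps_nth (core_factor l 1 - 1) 0 = 0" by simp
    then show ?thesis by (simp add: F_def)
  qed
  ultimately have "?f has_prod F"
    by (auto simp: has_prod_def raw_has_prod_def)
  then show ?thesis
    unfolding core_gf_def by (metis has_prod_unique)
qed

end

theory Submission
  imports Defs "HOL-Library.Numeral_Type"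
begin

text \<open>
  Write \<open>\<Delta> = q \<Prod> (1 - q\<^sup>n)\<^bsup>24\<^esup>\<close> and let \<open>U\<close> be the operator that sends \<open>\<Sum> c(n) q\<^sup>n\<close> to \<open>\<Sum> c(13n) q\<^sup>n\<close>. Since
  \<open>(1 - q\<^bsup>13n\<^esup>)\<^bsup>13\<^esup>\<close> is \<open>(1 - q\<^sup>n)\<^bsup>169\<^esup>\<close> modulo \<open>13\<close>, the generating function of the \<open>13\<close>-cores, multiplied by
  \<open>q\<^sup>7\<close>, is congruent to \<open>\<Delta>\<^sup>7\<close>. The proof rests on two congruences modulo \<open>13\<close>,

    \<open>U(\<Delta>\<^sup>7) = 11 \<Delta>\<close>  (\<open>hecke_Delta_power_7\<close>)  and  \<open>U(\<Delta>) = 8 \<Delta>\<close>  (\<open>hecke_Delta\<close>).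

  They show that \<open>a\<^sub>1\<^sub>3(13\<^bsup>2r\<^esup> - 7)\<close> is congruent to \<open>11 \<sqdot> 8\<^bsup>2r-1\<^esup>\<close>, so \<open>m = 1\<close> works for every \<open>r\<close>. For \<open>17\<close>
  also \<open>m = 1\<close> works, because \<open>a\<^sub>1\<^sub>7(5)\<close> is the number \<open>7\<close> of partitions of \<open>5\<close>.

  In the theory of modular forms the two congruences hold because \<open>U\<close> maps cusp forms of weight \<open>84\<close>
  and \<open>12\<close> to cusp forms of weight \<open>12\<close> modulo \<open>13\<close>. A direct proof uses the derivation
  \<open>D = q d/dq\<close>: modulo \<open>13\<close>, \<open>U\<close> kills every \<open>Dg\<close> and maps \<open>f\<^bsup>13\<^esup>\<close> to \<open>f\<close>. So it suffices to exhibit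
  series \<open>g\<close> with \<open>\<Delta> - 8 \<Delta>\<^bsup>13\<^esup> = Dg\<close> or \<open>\<Delta>\<^sup>7 - 11 \<Delta>\<^bsup>13\<^esup> = Dg\<close>. They are found in the ring generated by the
  Eisenstein series \<open>E\<^sub>4\<close> and \<open>E\<^sub>6\<close>, where \<open>D\<close> acts by explicit formulas modulo \<open>13\<close>. These
  formulas follow from three facts: \<open>1728 \<Delta> = E\<^sub>4\<^sup>3 - E\<^sub>6\<^sup>2\<close>, the bracket
  \<open>3 E\<^sub>6 DE\<^sub>4 - 2 E\<^sub>4 DE\<^sub>6 = E\<^sub>4\<^sup>3 - E\<^sub>6\<^sup>2\<close>, and the congruence \<open>3 E\<^sub>6\<^sup>2 - E\<^sub>4\<^sup>3 = 2\<close> modulo \<open>13\<close>, which expresses that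
  the Eisenstein series of weight \<open>12\<close> is \<open>1\<close> modulo \<open>13\<close>.

  All three facts have an elementary source. The series \<open>x = \<theta>(q)\<^sup>2\<close> and \<open>y = \<theta>(-q)\<^sup>2\<close>, where \<open>\<theta>(q)\<close> is the
  sum of \<open>q\<^bsup>n\<^sup>2\<^esup>\<close> over all integers \<open>n\<close>, are transformed by the arithmetic-geometric mean when \<open>q\<close> is replaced
  by \<open>q\<^sup>2\<close>. If both sides of a conjectured identity between expressions in \<open>x\<close>, \<open>y\<close> and their derivatives
  vanish at \<open>q = 0\<close> and change in the same way under this substitution, the identity holds as soon as the
  coefficients at \<open>q\<close> agree (\<open>dilation_eq_0\<close>). This gives the Wronskian of \<open>x\<close> and \<open>y\<close>, from which the
  bracket is computed, and, together with Gauss' product for \<open>\<theta>(-q)\<close>, the expression of \<open>\<Delta>\<close> by \<open>x\<close> and \<open>y\<close>.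
  The form of weight \<open>12\<close> is constant because it is invariant under \<open>q \<mapsto> q\<^sup>2\<close> modulo \<open>13\<close>.
\<close>

unbundle no vec_syntax
unbundle fps_syntax

section \<open>Congruences between power series\<close>

lemma fps_X_power_dvd_iff:
  fixes f :: "'a :: comm_ring_1 fps"
  shows "fps_X ^ n dvd f \<longleftrightarrow> (\<forall>k<n. f $ k = 0)"
proof
  assume "fps_X ^ n dvd f"
  then show "\<forall>k<n. f $ k = 0"
    by (auto simp: dvd_def fps_X_power_mult_nth)
next
  assume "\<forall>k<n. f $ k = 0"
  then have "f = fps_X ^ n * fps_shift n f"
    by (auto simp: fps_eq_iff fps_X_power_mult_nth)
  then show "fps_X ^ n dvd f"
    by (metis dvd_triv_left)
qed

lemma fps_eqI_mod_X_power:
  fixes f g :: "'a :: comm_ring_1 fps"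
  assumes "\<And>n. fps_X ^ Suc n dvd f - g"
  shows "f = g"
proof (rule fps_ext)
  fix n
  from assms[of n] show "f $ n = g $ n"
    by (simp add: fps_X_power_dvd_iff del: power_Suc)
qed

lemma dvd_diff_mult:
  fixes a b c d m :: "'a :: comm_ring_1"
  assumes "m dvd a - b" "m dvd c - d"
  shows "m dvd a * c - b * d"
proof -
  have "a * c - b * d = (a - b) * c + b * (c - d)"
    by (simp add: algebra_simps)
  then show ?thesis
    using assms by simp
qed

lemma dvd_diff_power:
  fixes a b m :: "'a :: comm_ring_1"
  assumes "m dvd a - b"
  shows "m dvd a ^ n - b ^ n"
  by (induction n) (simp_all add: dvd_diff_mult assms)

lemma dvd_diff_trans:
  fixes a b c m :: "'a :: comm_ring_1"
  assumes "m dvd a - b" "m dvd b - c"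
  shows "m dvd a - c"
  using dvd_add[OF assms] by simp

lemma dvd_diff_sym:
  fixes a b m :: "'a :: comm_ring_1"
  assumes "m dvd a - b"
  shows "m dvd b - a"
  using assms by (metis dvd_minus_iff minus_diff_eq)

lemma fps_nth_compose_X_power:
  fixes f :: "'a :: comm_ring_1 fps"
  assumes "k > 0"
  shows "(f oo fps_X ^ k) $ n = (if k dvd n then f $ (n div k) else 0)"
proof -
  have "(f oo fps_X ^ k) $ n = (\<Sum>i=0..n. f $ i * (if n = k * i then 1 else 0))"
    by (simp add: fps_compose_nth flip: power_mult)
  also have "\<dots> = (if k dvd n then f $ (n div k) else 0)"
  proof (cases "k dvd n")
    case True
    then obtain m where m: "n = k * m" by blast
    have "(\<Sum>i=0..n. f $ i * (if n = k * i then 1 else 0)) = (\<Sum>i\<in>{m}. f $ i)"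
      using assms by (intro sum.mono_neutral_cong_right) (auto simp: m)
    then show ?thesis using assms by (simp add: m)
  next
    case False
    then have "n \<noteq> k * i" for i by auto
    then show ?thesis using False by simp
  qed
  finally show ?thesis .
qed

lemma fps_X_power_dvd_compose:
  fixes f g :: "int fps"
  assumes "fps_X ^ n dvd f" "g $ 0 = 0"
  shows "g ^ n dvd f oo g"
proof -
  obtain h where "f = fps_X ^ n * h" using assms(1) by blast
  then have "f oo g = g ^ n * (h oo g)"
    using assms(2) by (simp add: fps_compose_mult_distrib flip: fps_compose_power)
  then show ?thesis by simp
qed

section \<open>The Euler product and the generating function of cores\<close>

definition euler_partial :: "nat \<Rightarrow> int fps" where
  "euler_partial N = (\<Prod>k=1..N. 1 - fps_X ^ k)"

definition euler :: "int fps" where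
  "euler = Abs_fps (\<lambda>j. euler_partial j $ j)"

lemma euler_partial_Suc: "euler_partial (Suc N) = euler_partial N * (1 - fps_X ^ Suc N)"
  by (simp add: euler_partial_def)

lemma euler_partial_nth_stable:
  assumes "j \<le> N"
  shows "euler_partial N $ j = euler_partial j $ j"
  using assms
proof (induction N rule: dec_induct)
  case (step N)
  have "euler_partial (Suc N) = euler_partial N - fps_X ^ Suc N * euler_partial N"
    unfolding euler_partial_Suc by (simp add: algebra_simps)
  with step show ?case
    by (simp add: fps_X_power_mult_nth del: power_Suc)
qed simp

lemma euler_approx: "fps_X ^ Suc N dvd euler - euler_partial N"
  unfolding fps_X_power_dvd_iff
proof (intro allI impI)
  fix j assume "j < Suc N"
  then show "(euler - euler_partial N) $ j = 0"
    using euler_partial_nth_stable[of j N] by (simp add: euler_def)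
qed

lemma euler_nth_0 [simp]: "euler $ 0 = 1"
  by (simp add: euler_def euler_partial_def)

lemma euler_approx_compose:
  assumes "l > 0"
  shows "fps_X ^ Suc N dvd (euler oo fps_X ^ l) - (euler_partial N oo fps_X ^ l)"
proof -
  have "(fps_X ^ l) ^ Suc N dvd (euler - euler_partial N) oo (fps_X ^ l)"
    using assms by (intro fps_X_power_dvd_compose euler_approx) simp
  moreover have "fps_X ^ Suc N dvd (fps_X ^ l) ^ Suc N"
    using assms by (simp add: le_imp_power_dvd dvd_power_same del: power_Suc)
  ultimately show ?thesis
    by (metis dvd_trans fps_compose_sub_distrib)
qed

lemma euler_partial_compose:
  assumes "l > 0"
  shows "euler_partial N oo fps_X ^ l = (\<Prod>k=1..N. 1 - fps_X ^ (l * k))"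
proof -
  have "(1 - fps_X ^ k) oo fps_X ^ l = 1 - (fps_X :: int fps) ^ (l * k)" for k
    using fps_compose_power[of "fps_X ^ l" "fps_X :: int fps" k] assms
    by (simp add: fps_compose_sub_distrib flip: power_mult)
  then show ?thesis
    using assms by (simp add: euler_partial_def fps_compose_prod_distrib)
qed

lemma core_gf_nth: "core_gf l $ j = (\<Prod>n\<le>j. core_factor l (Suc n)) $ j"
proof -
  have "(\<lambda>N. \<Prod>n\<le>N. core_factor l (Suc n)) \<longlonglongrightarrow> core_gf l"
    by (rule has_prod_imp_tendsto[OF core_gf_has_prod])
  then have "eventually (\<lambda>N. (\<Prod>n\<le>N. core_factor l (Suc n)) $ j = core_gf l $ j) sequentially"
    by (simp add: tendsto_fps_iff)
  then have "eventually (\<lambda>N. N \<ge> j \<and> (\<Prod>n\<le>N. core_factor l (Suc n)) $ j = core_gf l $ j) sequentially"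
    using eventually_ge_at_top by (rule eventually_conj[rotated])
  then obtain N where "N \<ge> j" "(\<Prod>n\<le>N. core_factor l (Suc n)) $ j = core_gf l $ j"
    by (auto simp: eventually_sequentially)
  then show ?thesis
    using partial_product_nth_stable by metis
qed

text \<open>
  Multiplying the factor at \<open>n\<close> by \<open>1 - q\<^sup>n\<close> turns it into \<open>(1 - q\<^bsup>ln\<^esup>)\<^sup>l\<close>; this holds for the finite
  products, which agree with the infinite ones up to any prescribed order.
\<close>

lemma core_gf_mult_euler:
  assumes "l > 0"
  shows "core_gf l * euler = (euler oo fps_X ^ l) ^ l"
proof (rule fps_eqI_mod_X_power)
  fix N
  define C where "C = (\<Prod>n\<le>N. core_factor l (Suc n))"
  have C: "fps_X ^ Suc N dvd core_gf l - C"
    unfolding fps_X_power_dvd_iff C_def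
  proof (intro allI impI)
    fix j assume "j < Suc N"
    then show "(core_gf l - (\<Prod>n\<le>N. core_factor l (Suc n))) $ j = 0"
      using partial_product_nth_stable[of j N l] by (simp add: core_gf_nth)
  qed
  have E: "fps_X ^ Suc N dvd euler - euler_partial (Suc N)"
    using euler_approx[of "Suc N"] by (rule dvd_trans[rotated]) (simp add: le_imp_power_dvd del: power_Suc)
  have E': "fps_X ^ Suc N dvd (euler oo fps_X ^ l) - (euler_partial (Suc N) oo fps_X ^ l)"
    using euler_approx_compose[OF assms, of "Suc N"]
    by (rule dvd_trans[rotated]) (simp add: le_imp_power_dvd del: power_Suc)
  have shift: "(\<Prod>k=1..Suc N. g k) = (\<Prod>n\<le>N. g (Suc n))" for g :: "nat \<Rightarrow> int fps"
    by (induction N) simp_all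
  have "C * euler_partial (Suc N) =
          (\<Prod>n\<le>N. (1 - fps_X ^ Suc n) * core_factor l (Suc n))"
    unfolding C_def euler_partial_def shift prod.distrib by (rule mult.commute)
  also have "\<dots> = (\<Prod>n\<le>N. (1 - fps_X ^ (l * Suc n)) ^ l)"
    by (intro prod.cong core_factor_mult) auto
  also have "\<dots> = (euler_partial (Suc N) oo fps_X ^ l) ^ l"
    unfolding euler_partial_compose[OF assms] shift by (rule prod_power_distrib[symmetric])
  finally have "C * euler_partial (Suc N) = (euler_partial (Suc N) oo fps_X ^ l) ^ l" .
  then have "fps_X ^ Suc N dvd core_gf l * euler - (euler_partial (Suc N) oo fps_X ^ l) ^ l"
    using dvd_diff_mult[OF C E] by simp
  then show "fps_X ^ Suc N dvd core_gf l * euler - (euler oo fps_X ^ l) ^ l"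
    by (rule dvd_diff_trans) (rule dvd_diff_sym[OF dvd_diff_power[OF E']])
qed

section \<open>Gauss' product formula for the theta series\<close>

definition theta :: "int fps" where
  "theta = Abs_fps (\<lambda>n. int (card {a :: int. a ^ 2 = int n}))"

text \<open>
  Gauss' formula \<open>\<theta>(-q) = \<Prod>\<^sub>k (1 - q\<^sup>k) / (1 + q\<^sup>k)\<close> follows from a finite identity in the style of Shanks.
  Let \<open>P\<^sub>n\<close> be the partial product for \<open>k \<le> n\<close>. Then the partial sum \<open>\<Sum> (-1)\<^sup>j q\<^bsup>j\<^sup>2\<^esup>\<close> over \<open>\<bar>j\<bar> \<le> n\<close> equals
  the sum over \<open>s \<le> n\<close> of \<open>(-1)\<^sup>s q\<^bsup>s(n+1)\<^esup> (2 / (1 + q\<^sup>s)) (P\<^sub>n / P\<^sub>s)\<close>, whose term at \<open>s = 0\<close> is \<open>P\<^sub>n\<close> and whose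
  other terms are divisible by \<open>q\<^bsup>n+1\<^esup>\<close>. The summands below are these terms multiplied by
  \<open>\<Prod> (1 + q\<^sup>k)\<close> over \<open>1 \<le> k \<le> n\<close>, which removes all denominators; the factor at \<open>k = 0\<close> of the last
  product is the \<open>2\<close>, and it is absent for \<open>s = 0\<close>.
\<close>

context
  fixes q :: "'a :: comm_ring_1"
begin

definition shanks :: "nat \<Rightarrow> nat \<Rightarrow> 'a" where
  "shanks n s = (-1) ^ s * q ^ (s * Suc n) * (\<Prod>k\<in>{s<..n}. 1 - q ^ k) * (\<Prod>k<s. 1 + q ^ k)"

text \<open>
  Passing from \<open>n\<close> to \<open>n + 1\<close> multiplies the summand at \<open>s\<close> by \<open>q\<^sup>s (1 - q\<^bsup>n+1\<^esup>)\<close>, while the common factor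
  grows by \<open>1 + q\<^bsup>n+1\<^esup>\<close>. The difference of these two multipliers is
  \<open>- (1 - q\<^sup>s) - q\<^bsup>n+1\<^esup> (1 + q\<^sup>s)\<close>, and the two parts cancel between neighbouring \<open>s\<close>.
\<close>

lemma shanks_telescope:
  assumes "m \<le> n"
  shows "(\<Sum>s\<le>m. shanks (Suc n) s - (1 + q ^ Suc n) * shanks n s) =
           - (q ^ Suc n * (1 + q ^ m) * shanks n m)"
  using assms
proof (induction m)
  case 0
  have "{0<..Suc n} = insert (Suc n) {0<..n}" by auto
  then show ?case by (simp add: shanks_def algebra_simps)
next
  case (Suc m)
  have "{Suc m<..Suc n} = insert (Suc n) {Suc m<..n}" using Suc.prems by auto
  then have 1: "shanks (Suc n) (Suc m) = q ^ Suc m * (1 - q ^ Suc n) * shanks n (Suc m)"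
    by (simp add: shanks_def algebra_simps power_add)
  have "{m<..n} = insert (Suc m) {Suc m<..n}" using Suc.prems by auto
  then have 2: "q ^ Suc n * (1 + q ^ m) * shanks n m = - ((1 - q ^ Suc m) * shanks n (Suc m))"
    by (simp add: shanks_def algebra_simps power_add)
  have "(\<Sum>s\<le>Suc m. shanks (Suc n) s - (1 + q ^ Suc n) * shanks n s) =
          - (q ^ Suc n * (1 + q ^ m) * shanks n m)
            + (shanks (Suc n) (Suc m) - (1 + q ^ Suc n) * shanks n (Suc m))"
    using Suc by simp
  also have "\<dots> = - (q ^ Suc n * (1 + q ^ Suc m) * shanks n (Suc m))"
    unfolding 1 2 by (simp add: algebra_simps del: power_Suc)
  finally show ?case .
qed

lemma shanks_identity:
  "(\<Sum>s\<le>n. shanks n s) = (\<Prod>k=1..n. 1 + q ^ k) * (1 + 2 * (\<Sum>s=1..n. (-1) ^ s * q ^ (s ^ 2)))"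
proof (induction n)
  case 0
  show ?case by (simp add: shanks_def)
next
  case (Suc n)
  define M where "M = (\<Prod>k=1..n. 1 + q ^ k)"
  have M: "(\<Prod>k<Suc n. 1 + q ^ k) = 2 * M"
    unfolding M_def by (subst prod.lessThan_Suc_shift) (simp add: prod.atLeast1_atMost_eq)
  have "(\<Sum>s\<le>Suc n. shanks (Suc n) s) =
          (\<Sum>s\<le>n. shanks (Suc n) s - (1 + q ^ Suc n) * shanks n s)
            + (1 + q ^ Suc n) * (\<Sum>s\<le>n. shanks n s) + shanks (Suc n) (Suc n)"
    by (simp add: sum_subtractf sum_distrib_left)
  also have "\<dots> = (1 + q ^ Suc n) * (\<Sum>s\<le>n. shanks n s)
                  + (shanks (Suc n) (Suc n) - q ^ Suc n * (1 + q ^ n) * shanks n n)"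
    by (subst shanks_telescope) simp_all
  also have "q ^ Suc n * (1 + q ^ n) * shanks n n =
               (-1) ^ n * q ^ (Suc n + n * Suc n) * ((1 + q ^ n) * (\<Prod>k<n. 1 + q ^ k))"
    by (simp add: shanks_def power_add mult_ac)
  also have "(1 + q ^ n) * (\<Prod>k<n. 1 + q ^ k) = 2 * M"
    using M by (simp add: mult.commute)
  also have "(-1) ^ n * q ^ (Suc n + n * Suc n) * (2 * M) = - ((-1) ^ Suc n * q ^ (Suc n ^ 2) * (2 * M))"
    by (simp add: power2_eq_square)
  also have "shanks (Suc n) (Suc n) = (-1) ^ Suc n * q ^ (Suc n ^ 2) * q ^ Suc n * (2 * M)"
    unfolding shanks_def M by (simp add: power2_eq_square power_add mult_ac)
  also have "(1 + q ^ Suc n) * (\<Sum>s\<le>n. shanks n s) +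
      ((-1) ^ Suc n * q ^ (Suc n ^ 2) * q ^ Suc n * (2 * M)
         - - ((-1) ^ Suc n * q ^ (Suc n ^ 2) * (2 * M))) =
      (1 + q ^ Suc n) * M * (1 + 2 * (\<Sum>s=1..Suc n. (-1) ^ s * q ^ (s ^ 2)))"
    unfolding Suc.IH M_def[symmetric] by (simp add: algebra_simps)
  finally show ?case by (simp add: M_def mult.commute)
qed

end

lemma sqrts_of_nat:
  "{a :: int. a ^ 2 = int n} = (if \<exists>s. n = s ^ 2 then {int (floor_sqrt n), - int (floor_sqrt n)} else {})"
proof (cases "\<exists>s. n = s ^ 2")
  case True
  then obtain s where "n = s ^ 2" by blast
  then show ?thesis by (auto simp: power2_eq_iff)
next
  case False
  have "n = nat \<bar>a\<bar> ^ 2" if "a ^ 2 = int n" for a :: int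
  proof -
    have "int (nat \<bar>a\<bar> ^ 2) = int n"
      using that by simp
    then show ?thesis by (simp only: of_nat_eq_iff)
  qed
  with False show ?thesis by auto
qed

lemma theta_nth: "theta $ n = (if n = 0 then 1 else if \<exists>s. n = s ^ 2 then 2 else 0)"
  by (auto simp: theta_def sqrts_of_nat card_insert_if)

lemma theta_alternating_approx:
  "fps_X ^ Suc n dvd (theta oo -fps_X) - (1 + 2 * (\<Sum>s=1..n. (-1) ^ s * fps_X ^ (s ^ 2)))"
  unfolding fps_X_power_dvd_iff
proof (intro allI impI)
  fix k assume k: "k < Suc n"
  have nth: "((-1) ^ s * fps_X ^ (s ^ 2) :: int fps) $ k = (if k = s ^ 2 then (-1) ^ s else 0)" for s
    by (cases "even s") simp_all
  have "(\<Sum>s=1..n. if k = s ^ 2 then (-1) ^ s else 0) = (if k > 0 \<and> (\<exists>s. k = s ^ 2) then (-1) ^ k else (0 :: int))"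
  proof (cases "k > 0 \<and> (\<exists>s. k = s ^ 2)")
    case True
    then obtain t where "k = t ^ 2" by blast
    with True have t: "k = t ^ 2" "t > 0" by (auto intro: gr0I)
    have "t \<le> n" using k t power2_nat_le_imp_le[of t n] by simp
    have "(\<Sum>s=1..n. if k = s ^ 2 then (-1) ^ s else 0) = (\<Sum>s\<in>{t}. (-1) ^ s :: int)"
      using t \<open>t \<le> n\<close> by (intro sum.mono_neutral_cong_right) auto
    then show ?thesis
      using True t by (simp add: minus_one_power_iff)
  qed auto
  then show "((theta oo -fps_X) - (1 + 2 * (\<Sum>s=1..n. (-1) ^ s * fps_X ^ (s ^ 2)))) $ k = 0"
    by (simp add: fps_compose_uminus' theta_nth fps_sum_nth nth numeral_fps_const)
qed

text \<open>
  Gauss' formula without denominators: \<open>\<Prod> (1 - q\<^sup>k) (1 + q\<^sup>k)\<close> is the Euler product at \<open>q\<^sup>2\<close>.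
\<close>

lemma gauss_theta: "(theta oo -fps_X) * (euler oo fps_X ^ 2) = euler ^ 2"
proof (rule fps_eqI_mod_X_power)
  fix n
  define T :: "int fps" where "T = 1 + 2 * (\<Sum>s=1..n. (-1) ^ s * fps_X ^ (s ^ 2))"
  define M :: "int fps" where "M = (\<Prod>k=1..n. 1 + fps_X ^ k)"
  have M: "euler_partial n oo fps_X ^ 2 = euler_partial n * M"
  proof -
    have "1 - fps_X ^ (2 * k) = (1 - fps_X ^ k) * (1 + fps_X ^ k :: int fps)" for k
      unfolding mult_2 power_add by (simp add: algebra_simps)
    then show ?thesis
      by (subst euler_partial_compose) (simp_all add: M_def euler_partial_def prod.distrib)
  qed
  have "fps_X ^ Suc n dvd (\<Sum>s=1..n. shanks (fps_X :: int fps) n s)"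
  proof (intro dvd_sum)
    fix s assume "s \<in> {1..n}"
    then have "Suc n \<le> s * Suc n" using mult_le_mono1[of 1 s "Suc n"] by simp
    then have "fps_X ^ Suc n dvd (fps_X :: int fps) ^ (s * Suc n)"
      by (rule le_imp_power_dvd)
    then show "fps_X ^ Suc n dvd shanks (fps_X :: int fps) n s"
      unfolding shanks_def by (intro dvd_mult2 dvd_mult)
  qed
  moreover have "M * T = (\<Sum>s\<le>n. shanks fps_X n s)"
    by (simp add: M_def T_def shanks_identity)
  moreover have "{..n} = insert 0 {1..n}" "{0<..n} = {1..n}" by auto
  then have "(\<Sum>s\<le>n. shanks (fps_X :: int fps) n s) = euler_partial n + (\<Sum>s=1..n. shanks fps_X n s)"
    by (simp add: shanks_def euler_partial_def)
  ultimately have "fps_X ^ Suc n dvd M * T - euler_partial n" by simp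
  then have "fps_X ^ Suc n dvd euler_partial n * (M * T - euler_partial n)" by (rule dvd_mult)
  then have *: "fps_X ^ Suc n dvd T * (euler_partial n oo fps_X ^ 2) - euler_partial n ^ 2"
    unfolding M by (simp add: algebra_simps power2_eq_square del: power_Suc)
  have "fps_X ^ Suc n dvd
         (theta oo -fps_X) * (euler oo fps_X ^ 2) - T * (euler_partial n oo fps_X ^ 2)"
    unfolding T_def by (intro dvd_diff_mult theta_alternating_approx euler_approx_compose) simp
  from dvd_diff_trans[OF this *]
  show "fps_X ^ Suc n dvd (theta oo -fps_X) * (euler oo fps_X ^ 2) - euler ^ 2"
    by (rule dvd_diff_trans) (rule dvd_diff_sym[OF dvd_diff_power[OF euler_approx]])
qed

section \<open>The arithmetic-geometric mean of theta series\<close>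

definition two_squares :: "nat \<Rightarrow> (int \<times> int) set" where
  "two_squares n = {(a, b). a ^ 2 + b ^ 2 = int n}"

lemma theta_power2_nth: "theta ^ 2 $ n = int (card (two_squares n))"
proof -
  define A where "A = (\<lambda>i. {a :: int. a ^ 2 = int i})"
  have "two_squares n = (\<Union>i\<in>{0..n}. A i \<times> A (n - i))"
  proof (intro set_eqI iffI; clarify)
    fix a b assume "(a, b) \<in> two_squares n"
    then have eq: "a ^ 2 + b ^ 2 = int n" by (simp add: two_squares_def)
    then have "a ^ 2 \<le> int n" using zero_le_power2[of b] by linarith
    then have "a \<in> A (nat (a ^ 2))" "nat (a ^ 2) \<le> n" "b \<in> A (n - nat (a ^ 2))"
      using eq by (auto simp: A_def of_nat_diff)
    then show "(a, b) \<in> (\<Union>i\<in>{0..n}. A i \<times> A (n - i))" by auto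
  next
    fix a b i assume "i \<in> {0..n}" "a \<in> A i" "b \<in> A (n - i)"
    then show "(a, b) \<in> two_squares n" by (auto simp: A_def two_squares_def of_nat_diff)
  qed
  also have "card \<dots> = (\<Sum>i=0..n. card (A i \<times> A (n - i)))"
  proof (rule card_UN_disjoint)
    have "finite (A i)" for i by (simp add: A_def sqrts_of_nat)
    then show "\<forall>i\<in>{0..n}. finite (A i \<times> A (n - i))" by simp
  qed (auto simp: A_def)
  finally show ?thesis
    by (simp add: power2_eq_square fps_mult_nth theta_def A_def card_cartesian_product)
qed

text \<open>
  The map \<open>(a, b) \<mapsto> (a + b, a - b)\<close> doubles \<open>a\<^sup>2 + b\<^sup>2\<close>, and it is onto because the two entries of a
  representation of an even number have the same parity.
\<close>

lemma card_two_squares_double: "card (two_squares (2 * n)) = card (two_squares n)"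
proof -
  define f :: "int \<times> int \<Rightarrow> int \<times> int" where "f = (\<lambda>(a, b). (a + b, a - b))"
  have "two_squares (2 * n) = f ` two_squares n"
  proof (intro set_eqI iffI; clarify)
    fix c d assume "(c, d) \<in> two_squares (2 * n)"
    then have eq: "c ^ 2 + d ^ 2 = 2 * int n" by (simp add: two_squares_def)
    then have "even (c ^ 2 + d ^ 2)" by simp
    then have "even (c + d)" by simp
    then obtain k where "c + d = 2 * k" by blast
    then have c: "c = 2 * k - d" by simp
    with eq have "(k, k - d) \<in> two_squares n"
      by (simp add: two_squares_def power2_eq_square algebra_simps)
    moreover have "(c, d) = f (k, k - d)" by (simp add: f_def c)
    ultimately show "(c, d) \<in> f ` two_squares n" by blast
  qed (auto simp: f_def two_squares_def power2_eq_square algebra_simps)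
  moreover have "inj f"
    by (auto simp: inj_def f_def)
  ultimately show ?thesis
    by (metis card_image inj_on_subset subset_UNIV)
qed

text \<open>
  With \<open>x = \<theta>(q)\<^sup>2\<close> and \<open>y = \<theta>(-q)\<^sup>2\<close>, replacing \<open>q\<close> by \<open>q\<^sup>2\<close> is one step of the arithmetic-geometric mean:
  \<open>x(q\<^sup>2) = (x + y) / 2\<close> and \<open>y(q\<^sup>2)\<^sup>2 = x y\<close>. Both equations are statements about the number of
  representations as a sum of two squares.
\<close>

definition theta3_sq :: "int fps" where "theta3_sq = theta ^ 2"
definition theta4_sq :: "int fps" where "theta4_sq = (theta oo -fps_X) ^ 2"

lemma theta4_sq_nth: "theta4_sq $ n = (-1) ^ n * theta3_sq $ n"
  unfolding theta4_sq_def theta3_sq_def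
  by (subst fps_compose_power) (simp_all add: fps_compose_uminus')

lemma theta_nth_simps [simp]:
  "theta $ 0 = 1" "theta $ Suc 0 = 2"
  "theta3_sq $ 0 = 1" "theta3_sq $ Suc 0 = 4" "theta4_sq $ 0 = 1" "theta4_sq $ Suc 0 = -4"
proof -
  have *: "\<exists>s. Suc 0 = s ^ 2" by (rule exI[of _ 1]) simp
  show 1: "theta $ 0 = 1" and 2: "theta $ Suc 0 = 2"
    using * by (simp_all add: theta_nth)
  show 3: "theta3_sq $ 0 = 1" and 4: "theta3_sq $ Suc 0 = 4"
    by (simp_all add: theta3_sq_def power2_eq_square fps_mult_nth 1 2)
  show "theta4_sq $ 0 = 1" "theta4_sq $ Suc 0 = -4"
    by (simp_all add: theta4_sq_nth 3 4)
qed

lemma theta_arithmetic_mean: "theta3_sq + theta4_sq = 2 * (theta3_sq oo fps_X ^ 2)"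
proof (rule fps_ext)
  fix n
  show "(theta3_sq + theta4_sq) $ n = (2 * (theta3_sq oo fps_X ^ 2)) $ n"
  proof (cases "even n")
    case True
    then obtain m where "n = 2 * m" by blast
    then show ?thesis
      by (simp add: theta4_sq_nth numeral_fps_const fps_nth_compose_X_power)
         (simp add: theta3_sq_def theta_power2_nth card_two_squares_double)
  next
    case False
    then show ?thesis
      by (simp add: theta4_sq_nth numeral_fps_const fps_nth_compose_X_power)
  qed
qed

text \<open>
  The coefficient at \<open>n\<close> counts the representations \<open>n = a\<^sup>2 + b\<^sup>2\<close> with sign \<open>(-1)\<^sup>b\<close>. For odd \<open>n\<close>, swapping
  \<open>a\<close> and \<open>b\<close> reverses the sign. For \<open>n = 2 m\<close> the sign is constant: \<open>a\<close> and \<open>b\<close> are both even or both odd,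
  and \<open>a\<^sup>2 + b\<^sup>2\<close> is \<open>0\<close> or \<open>2\<close> modulo \<open>4\<close> accordingly, so the sign is \<open>(-1)\<^sup>m\<close>.
\<close>

lemma theta_geometric_mean:
  "theta * (theta oo -fps_X) = theta4_sq oo fps_X ^ 2"
proof (rule fps_ext)
  fix n
  have lhs: "(theta * (theta oo -fps_X)) $ n = (\<Sum>i=0..n. theta $ i * theta $ (n - i) * (-1) ^ (n - i))"
    by (simp add: fps_mult_nth fps_compose_uminus' mult_ac)
  show "(theta * (theta oo -fps_X)) $ n = (theta4_sq oo fps_X ^ 2) $ n"
  proof (cases "even n")
    case True
    then obtain m where m: "n = 2 * m" by blast
    have "theta $ i * theta $ (n - i) * (-1) ^ (n - i) = (-1) ^ m * (theta $ i * theta $ (n - i))"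
      if "i \<le> n" for i
    proof (cases "theta $ i = 0 \<or> theta $ (n - i) = 0")
      case False
      then obtain s t where st: "i = s ^ 2" "n - i = t ^ 2"
        by (auto simp: theta_nth split: if_splits)
      then have eq: "s ^ 2 + t ^ 2 = 2 * m" using that m by simp
      then have "even (s ^ 2 + t ^ 2)" by simp
      then have "even (s + t)" by simp
      have "even (t ^ 2) \<longleftrightarrow> even m"
      proof (cases "even t")
        case True
        with \<open>even (s + t)\<close> obtain u v where "t = 2 * u" "s = 2 * v" by (auto elim!: evenE)
        with eq have "m = 2 * (u ^ 2 + v ^ 2)" by (simp add: power2_eq_square)
        with True show ?thesis by simp
      next
        case False
        with \<open>even (s + t)\<close> obtain u v where "t = 2 * u + 1" "s = 2 * v + 1" by (auto elim!: oddE)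
        with eq have "m = 2 * (u ^ 2 + v ^ 2 + u + v) + 1" by (simp add: power2_eq_square)
        with False show ?thesis by simp
      qed
      then show ?thesis unfolding st(2) by (simp add: minus_one_power_iff)
    qed auto
    then have "(theta * (theta oo -fps_X)) $ n = (\<Sum>i=0..n. (-1) ^ m * (theta $ i * theta $ (n - i)))"
      unfolding lhs by (intro sum.cong) auto
    also have "\<dots> = (-1) ^ m * theta3_sq $ n"
      by (simp add: theta3_sq_def power2_eq_square fps_mult_nth sum_distrib_left)
    finally show ?thesis
      by (simp add: m fps_nth_compose_X_power theta4_sq_nth)
         (simp add: theta3_sq_def theta_power2_nth card_two_squares_double)
  next
    case False
    have "(\<Sum>i=0..n. theta $ i * theta $ (n - i) * (-1) ^ (n - i))
            = (\<Sum>i=0..n. theta $ (n - i) * theta $ i * (-1) ^ i)"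
      by (subst sum.atLeastAtMost_rev) (auto intro!: sum.cong)
    also have "\<dots> = (\<Sum>i=0..n. - (theta $ i * theta $ (n - i) * (-1) ^ (n - i)))"
      using False by (intro sum.cong) (auto simp: minus_one_power_iff)
    finally have "(\<Sum>i=0..n. theta $ i * theta $ (n - i) * (-1) ^ (n - i)) = 0"
      by (simp add: sum_negf)
    then show ?thesis
      using False by (simp add: lhs fps_nth_compose_X_power)
  qed
qed

lemma theta_geometric_mean_sq: "(theta4_sq oo fps_X ^ 2) ^ 2 = theta3_sq * theta4_sq"
  unfolding theta_geometric_mean[symmetric] by (simp add: theta3_sq_def theta4_sq_def power_mult_distrib)

section \<open>The derivation of the theta constants and the discriminant\<close>

definition qD :: "'a :: comm_ring_1 fps \<Rightarrow> 'a fps" where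
  "qD f = fps_X * fps_deriv f"

lemma qD_nth: "qD f $ n = of_nat n * f $ n"
  by (cases n) (simp_all add: qD_def)

lemma qD_add: "qD (f + g) = qD f + qD g"
  and qD_diff: "qD (f - g) = qD f - qD g"
  and qD_mult: "qD (f * g) = f * qD g + g * qD f"
  and qD_numeral_mult: "qD (numeral w * f) = numeral w * qD f"
  and qD_power: "qD (f ^ n) = of_nat n * f ^ (n - 1) * qD f"
  and qD_numeral: "qD (numeral w) = 0"
  by (simp_all add: qD_def algebra_simps fps_deriv_power' numeral_fps_const)

lemmas qD_simps = qD_add qD_diff qD_mult qD_numeral_mult qD_power qD_numeral

lemma qD_compose_X_power:
  "k > 0 \<Longrightarrow> qD (f oo fps_X ^ k) = of_nat k * (qD f oo fps_X ^ k)"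
  by (auto simp: fps_eq_iff qD_nth fps_nth_compose_X_power simp flip: fps_of_nat)

text \<open>
  This rigidity turns relations between \<open>q\<close> and \<open>q\<^sup>2\<close> into identities. If \<open>C\<close> has order \<open>n\<close>, then
  \<open>C(q\<^sup>2)\<close> has order \<open>2 n\<close>, while the equation forces order \<open>n + 1\<close>; so \<open>n = 1\<close>, which the condition on the
  linear coefficient excludes.
\<close>

lemma dilation_eq_0:
  fixes a b C :: "int fps"
  assumes eq: "a * (C oo fps_X ^ 2) = b * C"
    and "a $ 0 \<noteq> 0" "b $ 0 = 0" "b $ 1 \<noteq> 0" "C $ 1 = 0"
  shows "C = 0"
proof (rule ccontr)
  assume C: "C \<noteq> 0"
  define n where "n = subdegree C"
  have Cn: "C $ n \<noteq> 0" and Cless: "\<And>k. k < n \<Longrightarrow> C $ k = 0"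
    using C by (auto simp: n_def)
  have "subdegree (C oo fps_X ^ 2) = 2 * n"
    by (rule subdegreeI) (use Cn Cless in \<open>auto simp: fps_nth_compose_X_power\<close>)
  moreover have "(C oo fps_X ^ 2) $ (2 * n) \<noteq> 0"
    using Cn by (simp add: fps_nth_compose_X_power)
  then have "C oo fps_X ^ 2 \<noteq> 0" by auto
  moreover have "subdegree a = 0" "subdegree b = 1"
    using assms by (auto intro!: subdegreeI)
  moreover have "a \<noteq> 0" "b \<noteq> 0"
    using assms by auto
  ultimately have "2 * n = 1 + n"
    using C arg_cong[OF eq, of subdegree] by (simp add: n_def)
  then show False
    using Cn assms(5) by simp
qed

text \<open>
  Differentiating the two equations of the arithmetic-geometric mean shows that both sides satisfy
  the same linear equation \<open>8 y(q\<^sup>2) C(q\<^sup>2) = (x - y) C(q)\<close>. Their linear coefficients are both \<open>16\<close>.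
\<close>

lemma theta_wronskian:
  "2 * (theta4_sq * qD theta3_sq - theta3_sq * qD theta4_sq) =
     theta3_sq * theta4_sq * (theta3_sq ^ 2 - theta4_sq ^ 2)"
proof -
  define x y where "x = theta3_sq" and "y = theta4_sq"
  define x1 y1 where "x1 = x oo fps_X ^ 2" and "y1 = y oo fps_X ^ 2"
  define u v where "u = qD x oo fps_X ^ 2" and "v = qD y oo fps_X ^ 2"
  define C where "C = 2 * (y * qD x - x * qD y) - x * y * (x ^ 2 - y ^ 2)"
  have am: "2 * x1 = x + y" and gm: "y1 ^ 2 = x * y"
    using theta_arithmetic_mean theta_geometric_mean_sq by (simp_all add: x_def y_def x1_def y1_def)
  have "qD x1 = 2 * u" "qD y1 = 2 * v"
    by (simp_all add: x1_def y1_def u_def v_def qD_compose_X_power)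
  then have u: "4 * u = qD x + qD y" and v: "4 * y1 * v = x * qD y + y * qD x"
    using arg_cong[OF am, of qD] arg_cong[OF gm, of qD] by (simp_all add: qD_simps mult.assoc)
  have C1: "C oo fps_X ^ 2 = 2 * (y1 * u - x1 * v) - x1 * y1 * (x1 ^ 2 - y1 ^ 2)"
    by (simp add: C_def x1_def y1_def u_def v_def fps_compose_sub_distrib fps_compose_mult_distrib
         fps_compose_power)
  have "8 * y1 * (C oo fps_X ^ 2) = (x - y) * C"
    unfolding C1 unfolding C_def using am gm u v by algebra
  then have "C = 0"
  proof (rule dilation_eq_0)
    show "(8 * y1) $ 0 \<noteq> 0" "(x - y) $ 0 = 0" "(x - y) $ 1 \<noteq> 0"
      by (simp_all add: y1_def x_def y_def)
    show "C $ 1 = 0"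
      by (simp add: C_def x_def y_def qD_nth fps_mult_nth_1 power2_eq_square)
  qed
  then show ?thesis
    by (simp add: C_def x_def y_def)
qed

definition delta :: "int fps" where
  "delta = fps_X * euler ^ 24"

text \<open>
  By Gauss' formula \<open>16 \<Delta>\<close> satisfies \<open>F\<^sup>2 = 16 y\<^bsup>12\<^esup> F(q\<^sup>2)\<close>, and by the arithmetic-geometric mean so does the
  theta expression \<open>E\<close>. Subtracting the two equations gives a linear one for \<open>E - F\<close> with
  coefficient \<open>E + F\<close>, which has order \<open>1\<close>.
\<close>

lemma delta_theta: "16 * delta = theta3_sq ^ 2 * theta4_sq ^ 8 * (theta3_sq ^ 2 - theta4_sq ^ 2)"
proof -
  define x y where "x = theta3_sq" and "y = theta4_sq"
  define x1 y1 where "x1 = x oo fps_X ^ 2" and "y1 = y oo fps_X ^ 2"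
  define E where "E = x ^ 2 * y ^ 8 * (x ^ 2 - y ^ 2)"
  define F where "F = 16 * delta"
  have am: "2 * x1 = x + y" and gm: "y1 ^ 2 = x * y"
    using theta_arithmetic_mean theta_geometric_mean_sq by (simp_all add: x_def y_def x1_def y1_def)
  have E1: "E oo fps_X ^ 2 = x1 ^ 2 * y1 ^ 8 * (x1 ^ 2 - y1 ^ 2)"
    by (simp add: E_def x1_def y1_def fps_compose_sub_distrib fps_compose_mult_distrib
         fps_compose_power)
  have E2: "16 * y ^ 12 * (E oo fps_X ^ 2) = E ^ 2"
    unfolding E1 unfolding E_def using am gm by algebra
  have "y ^ 12 * (euler oo fps_X ^ 2) ^ 24 = ((theta oo -fps_X) * (euler oo fps_X ^ 2)) ^ 24"
    by (simp add: y_def theta4_sq_def power_mult_distrib flip: power_mult)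
  also have "\<dots> = euler ^ 48"
    by (simp add: gauss_theta flip: power_mult)
  finally have e: "y ^ 12 * (euler oo fps_X ^ 2) ^ 24 = euler ^ 48" .
  have F1: "F oo fps_X ^ 2 = 16 * fps_X ^ 2 * (euler oo fps_X ^ 2) ^ 24"
    by (simp add: F_def delta_def fps_compose_mult_distrib fps_compose_power)
  have F2: "16 * y ^ 12 * (F oo fps_X ^ 2) = F ^ 2"
    using e unfolding F1 unfolding F_def delta_def by (simp add: power_mult_distrib flip: power_mult)
  have "16 * y ^ 12 * ((E - F) oo fps_X ^ 2) = (E + F) * (E - F)"
    using E2 F2 by (simp add: fps_compose_sub_distrib algebra_simps power2_eq_square)
  then have "E - F = 0"
  proof (rule dilation_eq_0)
    have 1: "f ^ n $ 1 = of_nat n * f $ 1" "f ^ n $ 0 = 1" if "f $ 0 = 1" for f :: "int fps" and n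
      using that by (induction n) (auto simp: fps_mult_nth_1 algebra_simps fps_nth_power_0)
    show "(16 * y ^ 12) $ 0 \<noteq> 0" by (simp add: y_def fps_nth_power_0)
    show "(E + F) $ 0 = 0" by (simp add: E_def F_def delta_def x_def y_def fps_nth_power_0)
    show "(E + F) $ 1 \<noteq> 0" "(E - F) $ 1 = 0"
      by (simp_all add: E_def F_def delta_def x_def y_def fps_mult_nth_1 1[simplified] fps_nth_power_0)
  qed
  then show ?thesis
    by (simp add: E_def F_def x_def y_def)
qed

section \<open>Eisenstein series in terms of theta constants\<close>

text \<open>
  These are the normalised Eisenstein series of weights \<open>4\<close> and \<open>6\<close>, written as polynomials in
  \<open>\<theta>(q)\<^sup>4\<close> and \<open>\<theta>(-q)\<^sup>4\<close>; what matters about them is contained in the next three lemmas.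
\<close>

definition E4 :: "int fps" where
  "E4 = 16 * theta3_sq ^ 4 - 16 * theta3_sq ^ 2 * theta4_sq ^ 2 + theta4_sq ^ 4"

definition E6 :: "int fps" where
  "E6 = (2 * theta3_sq ^ 2 - theta4_sq ^ 2) *
        (theta4_sq ^ 4 + 32 * theta3_sq ^ 2 * theta4_sq ^ 2 - 32 * theta3_sq ^ 4)"

lemma delta_E4_E6: "1728 * delta = E4 ^ 3 - E6 ^ 2"
proof -
  have "1728 * delta = 108 * (16 * delta)" by simp
  also have "\<dots> = E4 ^ 3 - E6 ^ 2"
    unfolding delta_theta E4_def E6_def by algebra
  finally show ?thesis .
qed

text \<open>
  For forms \<open>f\<close>, \<open>g\<close> that are homogeneous polynomials in \<open>x\<^sup>2\<close> and \<open>y\<^sup>2\<close>, Euler's relation shows that the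
  bracket \<open>(deg g) g Df - (deg f) f Dg\<close> is the Jacobian determinant of \<open>f\<close> and \<open>g\<close> times the same
  bracket of \<open>x\<^sup>2\<close> and \<open>y\<^sup>2\<close>, which is known from the Wronskian of \<open>x\<close> and \<open>y\<close>. The result is the
  combination of Ramanujan's differential equations in which the quasimodular \<open>E\<^sub>2\<close> cancels.
\<close>

lemma E4_E6_wronskian: "3 * E6 * qD E4 - 2 * E4 * qD E6 = E4 ^ 3 - E6 ^ 2"
proof -
  define x y where "x = theta3_sq" and "y = theta4_sq"
  have w: "2 * (y * qD x - x * qD y) = x * y * (x ^ 2 - y ^ 2)"
    using theta_wronskian by (simp add: x_def y_def)
  show ?thesis
    unfolding E4_def E6_def x_def[symmetric] y_def[symmetric]
    by (simp add: qD_simps) (use w in algebra)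
qed

text \<open>
  Modulo \<open>13\<close> the form \<open>3 E\<^sub>6\<^sup>2 - E\<^sub>4\<^sup>3\<close> is twice the Eisenstein series of weight \<open>12\<close>, the Hasse invariant.
  Its invariance under \<open>q \<mapsto> q\<^sup>2\<close> is a polynomial congruence, since the arithmetic-geometric mean
  expresses \<open>E\<^sub>4(q\<^sup>2)\<close> and \<open>E\<^sub>6(q\<^sup>2)\<close> by \<open>x\<close> and \<open>y\<close>.
\<close>

lemma hasse_dilation:
  "13 dvd 3 * E6 ^ 2 - E4 ^ 3 - ((3 * E6 ^ 2 - E4 ^ 3) oo fps_X ^ 2)"
proof -
  define x y where "x = theta3_sq" and "y = theta4_sq"
  define x1 y1 where "x1 = x oo fps_X ^ 2" and "y1 = y oo fps_X ^ 2"
  define H where "H = 3 * E6 ^ 2 - E4 ^ 3"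
  have am: "2 * x1 = x + y" and gm: "y1 ^ 2 = x * y"
    using theta_arithmetic_mean theta_geometric_mean_sq by (simp_all add: x_def y_def x1_def y1_def)
  define E41 E61 where "E41 = E4 oo fps_X ^ 2" and "E61 = E6 oo fps_X ^ 2"
  have E41: "E41 = 16 * x1 ^ 4 - 16 * x1 ^ 2 * y1 ^ 2 + y1 ^ 4"
    by (simp add: E41_def E4_def x_def y_def x1_def y1_def fps_compose_sub_distrib fps_compose_add_distrib fps_compose_mult_distrib
         fps_compose_power)
  have 4: "E41 = x ^ 4 - x ^ 2 * y ^ 2 + y ^ 4"
    unfolding E41 using am gm by algebra
  have E61: "E61 = (2 * x1 ^ 2 - y1 ^ 2) * (y1 ^ 4 + 32 * x1 ^ 2 * y1 ^ 2 - 32 * x1 ^ 4)"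
    by (simp add: E61_def E6_def x_def y_def x1_def y1_def fps_compose_sub_distrib fps_compose_add_distrib fps_compose_mult_distrib
         fps_compose_power)
  have 6: "2 * E61 = (2 * x ^ 2 - y ^ 2) * (x ^ 2 + y ^ 2) * (2 * y ^ 2 - x ^ 2)"
    unfolding E61 using am gm by algebra
  have "4 * (H - (H oo fps_X ^ 2)) = 4 * (3 * E6 ^ 2 - E4 ^ 3) - (3 * (2 * E61) ^ 2 - 4 * E41 ^ 3)"
    by (simp add: H_def E41_def E61_def fps_compose_sub_distrib fps_compose_mult_distrib
         fps_compose_power)
  also have "\<dots> = 13 * (2520 * x ^ 12 - 7560 * x ^ 10 * y ^ 2 + 8037 * x ^ 8 * y ^ 4
                          - 3474 * x ^ 6 * y ^ 6 + 405 * x ^ 4 * y ^ 8 + 72 * x ^ 2 * y ^ 10)"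
    unfolding 4 6 E4_def E6_def x_def[symmetric] y_def[symmetric] by algebra
  finally have *: "13 dvd 4 * (H - (H oo fps_X ^ 2))" by (rule dvdI)
  (* The factor 4 is invertible: 1 = 13 - 3 * 4. *)
  have "H - (H oo fps_X ^ 2) = 13 * (H - (H oo fps_X ^ 2)) - 3 * (4 * (H - (H oo fps_X ^ 2)))"
    by simp
  also have "13 dvd \<dots>"
    by (rule dvd_diff[OF dvd_triv_left dvd_mult[OF *]])
  finally show ?thesis by (simp add: H_def)
qed

section \<open>Power series modulo 13\<close>

definition red :: "int fps \<Rightarrow> 13 fps" where
  "red f = Abs_fps (\<lambda>n. of_int (f $ n))"

lemma red_nth: "red f $ n = of_int (f $ n)"
  by (simp add: red_def)

lemma red_diff: "red (f - g) = red f - red g"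
  and red_mult: "red (f * g) = red f * red g"
  and red_1: "red 1 = 1"
  and red_numeral: "red (numeral w) = numeral w"
  and red_X: "red fps_X = fps_X"
  and red_qD: "red (qD f) = qD (red f)"
  by (auto simp: fps_eq_iff red_nth fps_mult_nth qD_nth fps_numeral_nth fps_X_def)

lemma red_power: "red (f ^ n) = red f ^ n"
  by (induction n) (simp_all add: red_1 red_mult)

lemmas red_simps = red_diff red_mult red_1 red_numeral red_X red_qD red_power

lemma thirteen_eq_0: "(13 :: 13 fps) = 0"
  by (simp add: numeral_fps_const)

lemma red_eq_0: "13 dvd f \<Longrightarrow> red f = 0"
  by (auto simp: dvd_def red_simps thirteen_eq_0)

lemma fermat_mod_13: "(a :: 13) ^ 13 = a"
proof (cases a)
  case (of_int z)
  have "(of_nat n :: 13) ^ 13 = of_nat n" for n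
  proof (induction n)
    case (Suc n)
    have "(1 + of_nat n :: 13) ^ 13 = 1 ^ 13 + of_nat n ^ 13"
      by (rule freshmans_dream) simp_all
    with Suc show ?case by simp
  qed simp
  from this[of "nat z"] of_int show ?thesis by simp
qed

text \<open>
  Frobenius: split off the constant term and use additivity of the \<open>13\<close>-th power.
\<close>

lemma power_13_nth: "((f :: 13 fps) ^ 13) $ n = (if 13 dvd n then f $ (n div 13) else 0)"
proof (induction n arbitrary: f rule: less_induct)
  case (less n)
  define g where "g = fps_shift 1 f"
  have "f = fps_const (f $ 0) + fps_X * g"
    by (simp add: fps_eq_iff g_def)
  then have "f ^ 13 = (fps_const (f $ 0) + fps_X * g) ^ 13"
    by simp
  also have "\<dots> = fps_const (f $ 0) ^ 13 + (fps_X * g) ^ 13"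
    by (rule freshmans_dream) simp_all
  also have "\<dots> = fps_const (f $ 0) + fps_X ^ 13 * g ^ 13"
    by (simp add: fps_const_power fermat_mod_13 power_mult_distrib)
  finally have f: "f ^ 13 = fps_const (f $ 0) + fps_X ^ 13 * g ^ 13" .
  show ?case
  proof (cases "n < 13")
    case True
    then show ?thesis
      by (cases "n = 0") (auto simp: f fps_X_power_mult_nth dest: dvd_imp_le)
  next
    case False
    then obtain m where m: "n = m + 13" by (metis le_add_diff_inverse2 not_less)
    have "f ^ 13 $ n = (g ^ 13) $ m"
      by (simp add: f m fps_X_power_mult_nth)
    also have "\<dots> = (if 13 dvd m then g $ (m div 13) else 0)"
      by (rule less.IH) (simp add: m)
    also have "\<dots> = (if 13 dvd n then f $ (n div 13) else 0)"
      by (simp add: g_def m)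
    finally show ?thesis .
  qed
qed

lemma red_compose_X_power_13: "red (f oo fps_X ^ 13) = red f ^ 13"
  by (auto simp: fps_eq_iff red_nth fps_nth_compose_X_power power_13_nth)

lemma qD_nth_multiple_13: "qD (f :: 13 fps) $ (13 * k) = 0"
proof -
  have "(of_nat (13 * k) :: 13) = 0"
    by (simp only: of_nat_eq_0_iff_char_dvd) simp
  then show ?thesis by (simp only: qD_nth mult_zero_left)
qed

section \<open>The ring of modular forms modulo 13\<close>

definition e4 :: "13 fps" where "e4 = red E4"
definition e6 :: "13 fps" where "e6 = red E6"
definition Delta :: "13 fps" ("\<Delta>") where "\<Delta> = red delta"

text \<open>
  A series with \<open>H(q) = H(q\<^sup>2)\<close> is constant.
\<close>

lemma hasse_invariant: "3 * e6 ^ 2 - e4 ^ 3 = 2"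
proof -
  define H where "H = 3 * E6 ^ 2 - E4 ^ 3"
  have dil: "red H $ n = (if even n then red H $ (n div 2) else 0)" for n
  proof -
    have "red (H - (H oo fps_X ^ 2)) = 0"
      unfolding H_def by (rule red_eq_0[OF hasse_dilation])
    then have "red H $ n = red (H oo fps_X ^ 2) $ n"
      by (simp add: red_simps)
    then show ?thesis by (simp add: red_nth fps_nth_compose_X_power)
  qed
  have "red H $ n = 0" if "n > 0" for n
    using that
  proof (induction n rule: less_induct)
    case (less n)
    then show ?case using dil[of n] less.IH[of "n div 2"] by (cases "even n") auto
  qed
  moreover have "H $ 0 = 2"
    by (simp add: H_def E4_def E6_def fps_nth_power_0)
  ultimately have "red H = 2"
    by (simp add: fps_eq_iff fps_numeral_nth red_nth)
  then show ?thesis by (simp add: H_def e4_def e6_def red_simps)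
qed

lemma Delta_eq: "\<Delta> = e6 ^ 2 - e4 ^ 3"
proof -
  have "\<Delta> = 13 * (133 * \<Delta>) - 1728 * \<Delta>" by simp
  also have "1728 * \<Delta> = e4 ^ 3 - e6 ^ 2"
    using arg_cong[OF delta_E4_E6, of red] by (simp add: Delta_def e4_def e6_def red_simps)
  finally show ?thesis by (simp add: thirteen_eq_0)
qed

lemma wronskian: "3 * e6 * qD e4 - 2 * e4 * qD e6 = - \<Delta>"
  using arg_cong[OF E4_E6_wronskian, of red] by (simp add: Delta_eq e4_def e6_def red_simps)

lemma e4_cube: "e4 ^ 3 = 1 + 5 * \<Delta>"
  and e6_square: "e6 ^ 2 = 1 + 6 * \<Delta>"
proof -
  have "2 * e6 ^ 2 + \<Delta> = 3 * e6 ^ 2 - e4 ^ 3"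
    unfolding Delta_eq by (simp add: algebra_simps)
  then have two: "2 * e6 ^ 2 + \<Delta> = 2"
    unfolding hasse_invariant .
  have "e6 ^ 2 = 7 * (2 * e6 ^ 2 + \<Delta>) + 6 * \<Delta> - 13 * (e6 ^ 2 + \<Delta>)"
    by (simp add: algebra_simps)
  also have "\<dots> = 1 + 6 * \<Delta> + 13 * (1 - e6 ^ 2 - \<Delta>)"
    unfolding two by (simp add: algebra_simps)
  finally show 1: "e6 ^ 2 = 1 + 6 * \<Delta>" by (simp add: thirteen_eq_0)
  have "e4 ^ 3 = e6 ^ 2 - \<Delta>" by (simp add: Delta_eq)
  then show "e4 ^ 3 = 1 + 5 * \<Delta>" unfolding 1 by (simp add: algebra_simps)
qed

text \<open>
  Differentiating the relation \<open>3 E\<^sub>6\<^sup>2 - E\<^sub>4\<^sup>3 = 2\<close> gives a second linear equation for \<open>DE\<^sub>4\<close> and \<open>DE\<^sub>6\<close> beside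
  the bracket; the determinant of the system is again \<open>3 E\<^sub>6\<^sup>2 - E\<^sub>4\<^sup>3\<close> up to a unit, hence invertible. In this way the
  ring generated by \<open>E\<^sub>4\<close> and \<open>E\<^sub>6\<close> becomes closed under \<open>D\<close>; the last equation says that \<open>E\<^sub>2\<close> is
  \<open>E\<^sub>4\<^sup>2 E\<^sub>6\<close> modulo \<open>13\<close>.
\<close>

lemma qD_e4: "qD e4 = 6 * e6 * \<Delta>"
  and qD_e6: "qD e6 = 3 * e4 ^ 2 * \<Delta>"
  and qD_Delta: "qD \<Delta> = e4 ^ 2 * e6 * \<Delta>"
proof -
  have "qD (3 * e6 ^ 2 - e4 ^ 3) = 0"
    unfolding hasse_invariant by (rule qD_numeral)
  then have "6 * e6 * qD e6 = 3 * e4 ^ 2 * qD e4"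
    by (simp add: qD_simps mult.assoc)
  then have *: "6 * (e6 * qD e6) = 3 * (e4 ^ 2 * qD e4)"
    by (simp add: mult.assoc)
  (* Modulo 13 the inverses of 2, 3 and 4 are 7, 9 and 10. *)
  have "2 * (e6 * qD e6) = 9 * (6 * (e6 * qD e6)) - 13 * (4 * (e6 * qD e6))"
    by (simp add: algebra_simps)
  also have "\<dots> = e4 ^ 2 * qD e4 + 13 * (2 * (e4 ^ 2 * qD e4) - 4 * (e6 * qD e6))"
    unfolding * by (simp add: algebra_simps)
  finally have h: "2 * (e6 * qD e6) = e4 ^ 2 * qD e4"
    by (simp add: thirteen_eq_0)
  have "2 * qD e4 = 3 * e6 ^ 2 * qD e4 - e4 * (e4 ^ 2 * qD e4)"
    unfolding hasse_invariant[symmetric] by (simp add: algebra_simps power2_eq_square power3_eq_cube)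
  also have "\<dots> = e6 * (3 * e6 * qD e4 - 2 * e4 * qD e6)"
    unfolding h[symmetric] by (simp add: algebra_simps power2_eq_square)
  finally have 2: "2 * qD e4 = - (e6 * \<Delta>)"
    unfolding wronskian by simp
  have "qD e4 = 7 * (2 * qD e4) - 13 * qD e4"
    by (simp add: algebra_simps)
  also have "\<dots> = 6 * e6 * \<Delta> - 13 * (e6 * \<Delta> + qD e4)"
    unfolding 2 by (simp add: algebra_simps)
  finally show 4: "qD e4 = 6 * e6 * \<Delta>" by (simp add: thirteen_eq_0)
  have "4 * qD e6 = 2 * (2 * qD e6)" by simp
  also have "\<dots> = 3 * e6 * (2 * (e6 * qD e6)) - 2 * e4 ^ 3 * qD e6"
    unfolding hasse_invariant[symmetric] by (simp add: algebra_simps power2_eq_square)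
  also have "\<dots> = e4 ^ 2 * (3 * e6 * qD e4 - 2 * e4 * qD e6)"
    unfolding h by (simp add: algebra_simps power2_eq_square power3_eq_cube)
  finally have 3: "4 * qD e6 = - (e4 ^ 2 * \<Delta>)"
    unfolding wronskian by simp
  have "qD e6 = 10 * (4 * qD e6) - 13 * (3 * qD e6)"
    by (simp add: algebra_simps)
  also have "\<dots> = 3 * e4 ^ 2 * \<Delta> - 13 * (e4 ^ 2 * \<Delta> + 3 * qD e6)"
    unfolding 3 by (simp add: algebra_simps)
  finally show 6: "qD e6 = 3 * e4 ^ 2 * \<Delta>" by (simp add: thirteen_eq_0)
  have "qD \<Delta> = 2 * e6 * qD e6 - 3 * e4 ^ 2 * qD e4"
    unfolding Delta_eq by (simp add: qD_simps)
  also have "\<dots> = e4 ^ 2 * e6 * \<Delta> - 13 * (e4 ^ 2 * e6 * \<Delta>)"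
    unfolding 4 6 by (simp add: algebra_simps)
  finally show "qD \<Delta> = e4 ^ 2 * e6 * \<Delta>" by (simp add: thirteen_eq_0)
qed

section \<open>The operator U on cusp forms modulo 13\<close>

text \<open>
  For a polynomial \<open>a\<close> in \<open>\<Delta>\<close>, the derivative of \<open>E\<^sub>4 E\<^sub>6 a\<close> is again a polynomial in \<open>\<Delta>\<close>. The equations
  \<open>\<Delta> - c \<Delta>\<^bsup>13\<^esup> = Dg\<close> and \<open>\<Delta>\<^sup>7 - c \<Delta>\<^bsup>13\<^esup> = Dg\<close> with \<open>g = E\<^sub>4 E\<^sub>6 a\<close> thereby become systems of linear equations
  for the coefficients of \<open>a\<close>, which are solvable for exactly one \<open>c\<close> each. The shape of \<open>g\<close> is that of
  \<open>D\<^bsup>11\<^esup>\<Delta>\<close> and \<open>D\<^bsup>11\<^esup>\<Delta>\<^sup>7\<close>, whose weights \<open>34\<close> and \<open>106\<close> are \<open>10\<close> modulo \<open>12\<close>.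
\<close>

lemma qD_e4_e6_mult:
  assumes "qD a = b * (e4 ^ 2 * e6)"
  shows "qD (e4 * e6 * a) = (1 + 5 * \<Delta>) * (1 + 6 * \<Delta>) * b + \<Delta> * (9 + 51 * \<Delta>) * a"
proof -
  have "qD (e4 * e6 * a) = e4 ^ 3 * e6 ^ 2 * b + \<Delta> * (6 * e6 ^ 2 + 3 * e4 ^ 3) * a"
    unfolding qD_mult assms qD_e4 qD_e6 by (simp add: algebra_simps power2_eq_square power3_eq_cube)
  then show ?thesis
    unfolding e4_cube e6_square by (simp add: algebra_simps)
qed

text \<open>
  The polynomial \<open>a\<close> is the solution of the linear system for \<open>c = 8\<close>, and \<open>b\<close> is its derivative times \<open>\<Delta>\<close>.
  The large multiple of \<open>13\<close> accounts for representing all coefficients by integers.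
  Comparing coefficients at \<open>q\<^bsup>13k\<^esup>\<close> kills the derivative and turns \<open>\<Delta>\<^bsup>13\<^esup>\<close> into \<open>\<Delta>\<close>. The eigenvalue \<open>8\<close> is
  \<open>\<tau>(13) = -577738\<close> modulo \<open>13\<close>.
\<close>

lemma hecke_Delta: "\<Delta> $ (13 * k) = 8 * \<Delta> $ k"
proof -
  define a where "a = 8 + 7 * \<Delta> + 12 * \<Delta> ^ 2 + 12 * \<Delta> ^ 3
      + 9 * \<Delta> ^ 4 + 3 * \<Delta> ^ 5 + 4 * \<Delta> ^ 6 + \<Delta> ^ 7
      + 7 * \<Delta> ^ 8 + \<Delta> ^ 9 + 11 * \<Delta> ^ 11"
  define b where "b = 7 * \<Delta> + 24 * \<Delta> ^ 2 + 36 * \<Delta> ^ 3 + 36 * \<Delta> ^ 4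
      + 15 * \<Delta> ^ 5 + 24 * \<Delta> ^ 6 + 7 * \<Delta> ^ 7 + 56 * \<Delta> ^ 8
      + 9 * \<Delta> ^ 9 + 121 * \<Delta> ^ 11"
  have "qD a = b * (e4 ^ 2 * e6)"
    unfolding a_def b_def
    by (simp add: qD_simps qD_Delta) (simp add: algebra_simps eval_nat_numeral)
  then have "qD (e4 * e6 * a) = (1 + 5 * \<Delta>) * (1 + 6 * \<Delta>) * b + \<Delta> * (9 + 51 * \<Delta>) * a"
    by (rule qD_e4_e6_mult)
  also have "\<dots> = \<Delta> - 8 * \<Delta> ^ 13 + 13 * (6 * \<Delta> + 44 * \<Delta> ^ 2
      + 75 * \<Delta> ^ 3 + 144 * \<Delta> ^ 4 + 168 * \<Delta> ^ 5 + 135 * \<Delta> ^ 6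
      + 70 * \<Delta> ^ 7 + 82 * \<Delta> ^ 8 + 73 * \<Delta> ^ 9 + 165 * \<Delta> ^ 10
      + 34 * \<Delta> ^ 11 + 110 * \<Delta> ^ 12 + 323 * \<Delta> ^ 13)"
    unfolding a_def b_def by (simp add: algebra_simps eval_nat_numeral)
  finally have "\<Delta> = 8 * \<Delta> ^ 13 + qD (e4 * e6 * a)"
    by (simp add: thirteen_eq_0)
  from arg_cong[OF this, of "\<lambda>f. f $ (13 * k)"] show ?thesis
    by (simp add: qD_nth_multiple_13 power_13_nth numeral_fps_const)
qed

text \<open>
  Here \<open>a\<close> solves the linear system for \<open>c = 11\<close>. The eigenvalue is the coefficient of \<open>\<Delta>\<^sup>7\<close> at \<open>q\<^bsup>13\<^esup>\<close>, which is
  congruent to the number \<open>11\<close> of \<open>13\<close>-cores of \<open>6\<close>.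
\<close>

lemma hecke_Delta_power_7: "(\<Delta> ^ 7) $ (13 * k) = 11 * \<Delta> $ k"
proof -
  define a where "a = 2 + 8 * \<Delta> + 12 * \<Delta> ^ 2 + 11 * \<Delta> ^ 3
      + 7 * \<Delta> ^ 5 + 12 * \<Delta> ^ 6 + 3 * \<Delta> ^ 7 + 8 * \<Delta> ^ 8
      + 3 * \<Delta> ^ 9 + 7 * \<Delta> ^ 11"
  define b where "b = 8 * \<Delta> + 24 * \<Delta> ^ 2 + 33 * \<Delta> ^ 3 + 35 * \<Delta> ^ 5
      + 72 * \<Delta> ^ 6 + 21 * \<Delta> ^ 7 + 64 * \<Delta> ^ 8 + 27 * \<Delta> ^ 9
      + 77 * \<Delta> ^ 11"
  have "qD a = b * (e4 ^ 2 * e6)"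
    unfolding a_def b_def
    by (simp add: qD_simps qD_Delta) (simp add: algebra_simps eval_nat_numeral)
  then have "qD (e4 * e6 * a) = (1 + 5 * \<Delta>) * (1 + 6 * \<Delta>) * b + \<Delta> * (9 + 51 * \<Delta>) * a"
    by (rule qD_e4_e6_mult)
  also have "\<dots> = \<Delta> ^ 7 - 11 * \<Delta> ^ 13 + 13 * (2 * \<Delta>
      + 22 * \<Delta> ^ 2 + 81 * \<Delta> ^ 3 + 138 * \<Delta> ^ 4 + 122 * \<Delta> ^ 5
      + 40 * \<Delta> ^ 6 + 179 * \<Delta> ^ 7 + 238 * \<Delta> ^ 8 + 122 * \<Delta> ^ 9
      + 204 * \<Delta> ^ 10 + 80 * \<Delta> ^ 11 + 70 * \<Delta> ^ 12 + 206 * \<Delta> ^ 13)"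
    unfolding a_def b_def by (simp add: algebra_simps eval_nat_numeral)
  finally have "\<Delta> ^ 7 = 11 * \<Delta> ^ 13 + qD (e4 * e6 * a)"
    by (simp add: thirteen_eq_0)
  from arg_cong[OF this, of "\<lambda>f. f $ (13 * k)"] show ?thesis
    by (simp add: qD_nth_multiple_13 power_13_nth numeral_fps_const)
qed

section \<open>The generating function of 13-cores modulo 13\<close>

text \<open>
  Modulo \<open>13\<close> the product \<open>\<Prod> (1 - q\<^bsup>13n\<^esup>)\<^bsup>13\<^esup>\<close> is \<open>\<Prod> (1 - q\<^sup>n)\<^bsup>169\<^esup>\<close>, and \<open>168 = 7 \<sqdot> 24\<close>.
\<close>

lemma red_core_gf_13: "red (fps_X ^ 7 * core_gf 13) = \<Delta> ^ 7"
proof -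
  define p where "p = red euler"
  have "red (core_gf 13) * p = (p ^ 13) ^ 13"
    using arg_cong[OF core_gf_mult_euler[of 13], of red]
    by (simp add: red_simps red_compose_X_power_13 p_def)
  also have "\<dots> = p ^ 168 * p"
    by (simp flip: power_mult power_Suc2)
  finally have eq: "red (core_gf 13) * p = p ^ 168 * p" .
  have "p * fps_right_inverse p 1 = 1"
    by (rule fps_right_inverse) (simp add: p_def red_nth)
  then have "red (core_gf 13) = p ^ 168"
    using arg_cong[OF eq, of "\<lambda>f. f * fps_right_inverse p 1"] by (simp only: mult.assoc mult_1_right)
  then show ?thesis
    by (simp add: Delta_def delta_def red_simps p_def power_mult_distrib flip: power_mult)
qed

lemma num_cores_13_not_cong:
  assumes "r > 0"
  shows "\<not> [num_cores 13 (13 ^ (2 * r) - 7) = 0] (mod 13)"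
proof -
  define n :: nat where "n = 13 ^ (2 * r) - 7"
  obtain j where j: "2 * r = Suc j" using assms by (cases "2 * r") auto
  have "(13 :: nat) ^ 1 \<le> 13 ^ (2 * r)" using assms by (intro power_increasing) auto
  then have n: "13 ^ (2 * r) = n + 7" by (simp add: n_def)
  have Delta_power: "\<Delta> $ (13 ^ i) = 8 ^ i" for i
  proof (induction i)
    case 0
    show ?case by (simp add: Delta_def delta_def red_nth fps_mult_nth_1 fps_nth_power_0)
  next
    case (Suc i)
    then show ?case by (simp add: hecke_Delta)
  qed
  have "of_int (core_gf 13 $ n) = red (fps_X ^ 7 * core_gf 13) $ (n + 7)"
    by (simp add: red_nth fps_X_power_mult_nth)
  also have "\<dots> = (\<Delta> ^ 7) $ (13 * 13 ^ j)"
    by (simp add: red_core_gf_13 j flip: n)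
  also have "\<dots> = of_nat (11 * 8 ^ j)"
    by (simp add: hecke_Delta_power_7 Delta_power)
  finally have *: "(of_int (core_gf 13 $ n) :: 13) = of_nat (11 * 8 ^ j)" .
  have "\<not> 13 dvd 11 * (8 :: nat) ^ j"
    using prime_dvd_power[of "13 :: nat" 8 j] by (auto simp: prime_dvd_mult_iff)
  then have "(of_nat (11 * 8 ^ j) :: 13) \<noteq> 0"
    unfolding of_nat_eq_0_iff_char_dvd by simp
  with * have "\<not> [core_gf 13 $ n = 0] (mod 13)"
    using of_int_eq_iff_cong_CHAR[where ?'a = 13, of "core_gf 13 $ n" 0] by simp
  moreover have "(13 :: int) ^ (2 * r) = int (n + 7)"
    unfolding n[symmetric] by simp
  ultimately show ?thesis by (simp add: num_cores_def)
qed

section \<open>The 17-cores of 5\<close>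

text \<open>
  Below \<open>q\<^bsup>17\<^esup>\<close> the numerator of the generating function is \<open>1\<close>, so the number of \<open>17\<close>-cores of \<open>5\<close> is
  the number of partitions of \<open>5\<close>. The series \<open>P\<close> lists the numbers of partitions up to \<open>5\<close>.
\<close>

lemma num_cores_17_5: "num_cores 17 5 = 7"
proof -
  define P :: "int fps" where
    "P = 1 + fps_X + 2 * fps_X ^ 2 + 3 * fps_X ^ 3 + 5 * fps_X ^ 4 + 7 * fps_X ^ 5"
  define E where "E = euler_partial 5"
  have "P * E = 1 + fps_X ^ 6 * (-10 - 3 * fps_X + 5 * fps_X ^ 2 + 8 * fps_X ^ 3
      + 11 * fps_X ^ 4 + 6 * fps_X ^ 5 - 3 * fps_X ^ 6 - 14 * fps_X ^ 7 - 10 * fps_X ^ 8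
      - 5 * fps_X ^ 9 + 4 * fps_X ^ 10 + 6 * fps_X ^ 11 + 9 * fps_X ^ 12 + 2 * fps_X ^ 13 - 7 * fps_X ^ 14)"
    unfolding P_def E_def euler_partial_def
    by (simp add: numeral_eq_Suc) algebra
  then have PE: "fps_X ^ 6 dvd P * E - 1" by simp
  have "(fps_X ^ 17) ^ 1 dvd (euler - 1) oo fps_X ^ 17"
    using euler_approx[of 0] by (intro fps_X_power_dvd_compose) (simp_all add: euler_partial_def)
  then have "fps_X ^ 17 dvd (euler oo fps_X ^ 17) - 1"
    by (simp add: fps_compose_sub_distrib)
  then have "fps_X ^ 6 dvd (euler oo fps_X ^ 17) - 1"
    by (rule dvd_trans[rotated]) (simp add: le_imp_power_dvd)
  from dvd_diff_power[OF this, of 17]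
  have "fps_X ^ 6 dvd core_gf 17 * euler - 1"
    by (simp add: core_gf_mult_euler)
  moreover have "fps_X ^ 6 dvd core_gf 17 * E - core_gf 17 * euler"
    using dvd_diff_sym[OF euler_approx[of 5]] unfolding E_def by (intro dvd_diff_mult) simp_all
  ultimately have CE: "fps_X ^ 6 dvd core_gf 17 * E - 1"
    using dvd_diff_trans by blast
  have "core_gf 17 - P = P * (core_gf 17 * E - 1) - core_gf 17 * (P * E - 1)"
    by (simp add: algebra_simps)
  also have "fps_X ^ 6 dvd \<dots>"
    by (rule dvd_diff[OF dvd_mult[OF CE] dvd_mult[OF PE]])
  finally have "core_gf 17 $ 5 = P $ 5"
    by (simp add: fps_X_power_dvd_iff)
  also have "P $ 5 = 7"
    by (simp add: P_def numeral_fps_const)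
  finally show ?thesis by (simp add: num_cores_def)
qed

theorem corollary6p4:
  shows "(\<forall>r::nat. r > 0 \<longrightarrow>
            (\<exists>m::int. \<not> [num_cores 13 (13 ^ (2 * r) * m - 7) = 0] (mod 13))) \<and>
         (\<exists>m::int. \<not> [num_cores 17 (17 * m - 12) = 0] (mod 17))"
proof (intro conjI allI impI)
  fix r :: nat assume "r > 0"
  then show "\<exists>m::int. \<not> [num_cores 13 (13 ^ (2 * r) * m - 7) = 0] (mod 13)"
    using num_cores_13_not_cong[of r] by (intro exI[of _ 1]) simp
next
  have "\<not> [num_cores 17 (17 * 1 - 12) = 0] (mod 17)"
    by (simp add: num_cores_17_5 cong_def)
  then show "\<exists>m::int. \<not> [num_cores 17 (17 * m - 12) = 0] (mod 17)"
    by blast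
qed

end
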